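(* There is a family of $n$-node bounded-degree connected graphs $G=(V,E)$ (with $n\to\infty$) and an absolute constant $c>0$ such that for every $G$ in the family and every odd-weight node-labeling $\ell$ of $G$, every conical junta $h$ on the variables $z\in\{0,1\}^E$ satisfying $h(z)=|\mathrm{viol}(z)|-1$ for all $z\in\{0,1\}^E$ has degree at least $c\,n$.
   Context: For a connected graph $G=(V,E)$ and $\ell\in\mathbb{Z}_2^V$ with $\sum_v\ell(v)=1$ (mod 2), for $z\in\mathbb{Z}_2^E$ let $z(v)=\sum_{e\ni v}z(e)$ (mod 2) and $\mathrm{viol}(z)=\{v\in V: z(v)\ne\ell(v)\}$. A conical junta is a function $h=\sum_C w_C C$ where each $w_C\ge 0$ and $C$ ranges over conjunctions of literals (input bits or their negations) $C\colon\{0,1\}^E\to\{0,1\}$; its degree is the maximum number of literals in a conjunction $C$ with $w_C>0$. *)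

theory Defs
  imports Complex_Main
begin

text \<open>Graphs: vertex set {0..<n}, edges are 2-element subsets of the vertex set.\<close>

definition simple_graph :: "nat \<Rightarrow> nat set set \<Rightarrow> bool" where
  "simple_graph n E \<longleftrightarrow> (\<forall>e\<in>E. \<exists>u v. u \<noteq> v \<and> u < n \<and> v < n \<and> e = {u, v})"

definition graph_connected :: "nat \<Rightarrow> nat set set \<Rightarrow> bool" where
  "graph_connected n E \<longleftrightarrow>
     (\<forall>u<n. \<forall>v<n. (u, v) \<in> {(a, b). {a, b} \<in> E}\<^sup>*)"

definition max_degree_le :: "nat \<Rightarrow> nat set set \<Rightarrow> nat \<Rightarrow> bool" where
  "max_degree_le n E d \<longleftrightarrow> (\<forall>v<n. card {e\<in>E. v \<in> e} \<le> d)"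

text \<open>z(v) = sum over edges at v of z(e), mod 2 (True = 1).\<close>
definition node_parity :: "nat set set \<Rightarrow> (nat set \<Rightarrow> bool) \<Rightarrow> nat \<Rightarrow> bool" where
  "node_parity E z v \<longleftrightarrow> odd (card {e\<in>E. v \<in> e \<and> z e})"

definition viol :: "nat \<Rightarrow> nat set set \<Rightarrow> (nat \<Rightarrow> bool) \<Rightarrow> (nat set \<Rightarrow> bool) \<Rightarrow> nat set" where
  "viol n E lab z = {v. v < n \<and> node_parity E z v \<noteq> lab v}"

text \<open>A conjunction of literals is a pair (P, N): positive literals P, negated literals N.\<close>
definition conj_eval :: "nat set set \<times> nat set set \<Rightarrow> (nat set \<Rightarrow> bool) \<Rightarrow> real" where
  "conj_eval C z = (if (\<forall>e\<in>fst C. z e) \<and> (\<forall>e\<in>snd C. \<not> z e) then 1 else 0)"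

definition conj_width :: "nat set set \<times> nat set set \<Rightarrow> nat" where
  "conj_width C = card (fst C) + card (snd C)"

text \<open>Conical junta over the edge variables: finite set S of conjunctions over E with
  nonnegative weights w.\<close>
definition conical_junta ::
  "nat set set \<Rightarrow> (nat set set \<times> nat set set) set \<Rightarrow> (nat set set \<times> nat set set \<Rightarrow> real) \<Rightarrow> bool" where
  "conical_junta E S w \<longleftrightarrow> finite S \<and> (\<forall>C\<in>S. fst C \<subseteq> E \<and> snd C \<subseteq> E \<and> w C \<ge> 0)"

definition junta_eval ::
  "(nat set set \<times> nat set set) set \<Rightarrow> (nat set set \<times> nat set set \<Rightarrow> real) \<Rightarrow> (nat set \<Rightarrow> bool) \<Rightarrow> real" where
  "junta_eval S w z = (\<Sum>C\<in>S. w C * conj_eval C z)"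

text \<open>Degree: maximum width of a conjunction with positive weight (0 if none).\<close>
definition junta_degree ::
  "(nat set set \<times> nat set set) set \<Rightarrow> (nat set set \<times> nat set set \<Rightarrow> real) \<Rightarrow> nat" where
  "junta_degree S w = Max (insert 0 (conj_width ` {C\<in>S. w C > 0}))"

end

theory Submission
  imports Defs "HOL-Combinatorics.Permutations"
begin

text \<open>
  Take \<open>G\<close> to be an expander: deleting few edges leaves a connected class \<open>K\<close> containing more
  than \<open>7/8\<close> of the vertices. Every conjunction \<open>C\<close> of the junta must vanish on the assignments with
  a single violation, where \<open>|viol| - 1 = 0\<close>. Let \<open>f X\<close> be the number of assignments accepted by \<open>C\<close>
  with violation set \<open>X\<close>. Flipping the edges of a path avoiding the variables of \<open>C\<close> shows that
  \<open>f X\<close> does not change when \<open>X\<close> is modified by a pair of vertices of \<open>K\<close>. If \<open>C\<close> is narrow, extending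
  triples by pairs from \<open>K\<close> then gives that the average of \<open>f\<close> over quintuples is at least
  \<open>10/3 (7/8)\<^sup>2 > 2\<close> times its average over triples, asymptotically. But \<open>|viol| - 1\<close> is \<open>4\<close> on
  the former and \<open>2\<close> on the latter, so the ratio for the whole junta is exactly \<open>2\<close>.
\<close>

section \<open>Random permutations expand\<close>

lemma permutes_image_exists:
  assumes "finite V" "S \<subseteq> V" "T \<subseteq> V" "card S = card T"
  obtains p where "p permutes V" "p ` S = T"
proof -
  have fin: "finite S" "finite T" using assms finite_subset by auto
  obtain f where f: "bij_betw f S T"
    using finite_same_card_bij[OF fin assms(4)] by blast
  have "card (V - S) = card (V - T)"
    using assms fin by (simp add: card_Diff_subset)
  then obtain g where g: "bij_betw g (V - S) (V - T)"
    using finite_same_card_bij[of "V - S" "V - T"] assms(1) by blast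
  define p where "p x = (if x \<in> S then f x else if x \<in> V then g x else x)" for x
  have pS: "bij_betw p S T"
    using f by (rule bij_betw_cong[THEN iffD1, rotated]) (simp add: p_def)
  moreover have "bij_betw p (V - S) (V - T)"
    using g by (rule bij_betw_cong[THEN iffD1, rotated]) (simp add: p_def)
  ultimately have "bij_betw p (S \<union> (V - S)) (T \<union> (V - T))"
    by (rule bij_betw_combine) auto
  moreover have "S \<union> (V - S) = V" "T \<union> (V - T) = V" using assms by auto
  ultimately have "p permutes V"
    by (intro bij_imp_permutes) (use assms(2) in \<open>auto simp: p_def\<close>)
  moreover have "p ` S = T" using pS by (simp add: bij_betw_def)
  ultimately show thesis by (rule that)
qed

text \<open>The possible images of \<open>S\<close> partition the permutations of \<open>V\<close>,
  and composing with a permutation that takes \<open>U\<close> to \<open>U'\<close> shows that all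
  classes are equally large.\<close>

lemma card_permutes_image:
  assumes "finite V" "S \<subseteq> V" "T \<subseteq> V" "card S = card T"
  shows "card {p. p permutes V \<and> p ` S = T} * (card V choose card S) = fact (card V)"
proof -
  let ?A = "\<lambda>T. {p. p permutes V \<and> p ` S = T}"
  have fin: "finite (?A U)" for U
    using finite_permutations[OF assms(1)] by (rule rev_finite_subset) auto
  have le: "card (?A U) \<le> card (?A U')"
    if U: "U \<subseteq> V" "U' \<subseteq> V" "card U = card U'" for U U'
  proof -
    obtain r where r: "r permutes V" "r ` U = U'"
      by (rule permutes_image_exists[OF assms(1) U])
    have "inj_on (\<lambda>p. r \<circ> p) (?A U)"
      using permutes_inj[OF r(1)] by (auto simp: inj_on_def fun_eq_iff dest: injD)
    moreover have "(\<lambda>p. r \<circ> p) ` ?A U \<subseteq> ?A U'"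
      using r by (auto simp: permutes_compose image_comp[symmetric])
    ultimately show ?thesis using fin by (rule card_inj_on_le)
  qed
  let ?T = "{U. U \<subseteq> V \<and> card U = card S}"
  have finT: "finite ?T" using assms(1) by simp
  have "{p. p permutes V} = (\<Union>U\<in>?T. ?A U)"
  proof (intro equalityI subsetI)
    fix p assume "p \<in> {p. p permutes V}"
    then have p: "p permutes V" by simp
    have "p ` S \<subseteq> V" using p assms(2) by (auto simp: permutes_in_image)
    moreover have "card (p ` S) = card S"
      using permutes_inj[OF p] by (simp add: card_image inj_on_subset)
    ultimately show "p \<in> (\<Union>U\<in>?T. ?A U)" using p by auto
  qed auto
  then have "fact (card V) = card (\<Union>U\<in>?T. ?A U)"
    using card_permutations[OF refl assms(1)] by simp
  also have "\<dots> = (\<Sum>U\<in>?T. card (?A U))"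
    by (rule card_UN_disjoint) (use finT fin in auto)
  also have "\<dots> = (\<Sum>U\<in>?T. card (?A T))"
    by (intro sum.cong refl antisym le) (use assms in auto)
  also have "\<dots> = (card V choose card S) * card (?A T)"
    using n_subsets[OF assms(1), of "card S"] by simp
  finally show ?thesis by (simp add: mult.commute)
qed

text \<open>A Chernoff-type bound, obtained from the binomial expansion of \<open>(1 + 64)^n\<close>.\<close>

lemma card_small_subsets_le:
  assumes "finite V" "card V = 384 * q"
  shows "card {D. D \<subseteq> V \<and> card D \<le> 2 * q} \<le> 2 ^ (24 * q)"
proof -
  let ?n = "384 * q"
  have "{D. D \<subseteq> V \<and> card D \<le> 2 * q} = (\<Union>k\<le>2*q. {D. D \<subseteq> V \<and> card D = k})" by auto
  then have "card {D. D \<subseteq> V \<and> card D \<le> 2 * q} \<le> (\<Sum>k\<le>2*q. card {D. D \<subseteq> V \<and> card D = k})"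
    by (simp add: card_UN_le)
  also have "\<dots> = (\<Sum>k\<le>2*q. ?n choose k)" using n_subsets[OF assms(1)] assms(2) by simp
  finally have "card {D. D \<subseteq> V \<and> card D \<le> 2 * q} * 64 ^ (382 * q)
      \<le> (\<Sum>k\<le>2*q. ?n choose k) * 64 ^ (382 * q)" by simp
  also have "\<dots> \<le> (\<Sum>k\<le>2*q. (?n choose k) * 64 ^ (?n - k))"
    unfolding sum_distrib_right by (intro sum_mono mult_left_mono power_increasing) auto
  also have "\<dots> \<le> (\<Sum>k\<le>?n. (?n choose k) * 64 ^ (?n - k))"
    by (rule sum_mono2) auto
  also have "\<dots> = (1 + 64) ^ ?n" by (subst binomial) simp
  also have "\<dots> = (65 ^ 32) ^ (12 * q)" by (simp only: power_mult[symmetric]) simp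
  \<comment> \<open>Indeed (1 + 1/64)^32 < e^(1/2) < 2.\<close>
  also have "\<dots> \<le> (2 * 64 ^ 32) ^ (12 * q)" by (rule power_mono) simp_all
  also have "\<dots> = 2 ^ (12 * q) * (64 ^ (2 * q) * 64 ^ (382 * q))"
    by (simp only: power_mult_distrib power_mult[symmetric] power_add[symmetric]) simp
  also have "(64::nat) ^ (2 * q) = (2 ^ 6) ^ (2 * q)" by simp
  also have "\<dots> = 2 ^ (12 * q)" by (simp only: power_mult[symmetric]) simp
  also have "2 ^ (12 * q) * (2 ^ (12 * q) * 64 ^ (382 * q)) = 2 ^ (24 * q) * (64::nat) ^ (382 * q)"
    by (simp only: mult.assoc[symmetric] power_add[symmetric]) simp
  finally show ?thesis by simp
qed

text \<open>In probabilistic terms: at most 2^(24 q) of the equally likely images of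
  \<open>S\<close> are this close to \<open>S\<close>, and there are at least 2^(48 q) images in
  all. So a random permutation fails to expand \<open>S\<close> with probability at most 2^(-24 q).
  The bounds on \<open>card S\<close> are 1/8 and 1/2 of \<open>card V\<close>.\<close>

lemma card_nonexpanding_le:
  assumes V: "finite V" "card V = 384 * q" and S: "S \<subseteq> V" "48 * q \<le> card S" "card S \<le> 192 * q"
  shows "card {p. p permutes V \<and> card (p ` S - S) \<le> q} * 2 ^ (24 * q) \<le> fact (card V)"
proof (cases "q = 0")
  case True
  then have "V = {}" using V by simp
  then show ?thesis using True S by (simp add: permutes_empty)
next
  case False
  let ?B = "{p. p permutes V \<and> card (p ` S - S) \<le> q}"
  let ?A = "\<lambda>T. {p. p permutes V \<and> p ` S = T}"
  let ?T = "{T. T \<subseteq> V \<and> card T = card S \<and> card (T - S) \<le> q}"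
  let ?D = "{D. D \<subseteq> V \<and> card D \<le> 2 * q}"
  let ?c = "card V choose card S"
  have finS: "finite S" using S V finite_subset by blast
  \<comment> \<open>A near image is recovered from its symmetric difference with \<open>S\<close>,
    whose two halves are equally large because \<open>card T = card S\<close>.\<close>
  have "inj_on (\<lambda>T. sym_diff T S) ?T" by (auto simp: inj_on_def)
  moreover have "(\<lambda>T. sym_diff T S) ` ?T \<subseteq> ?D"
  proof clarify
    fix T assume T: "T \<subseteq> V" "card T = card S" "card (T - S) \<le> q"
    have finT: "finite T" using T V finite_subset by blast
    have "card (S - T) = card (T - S)"
      using T(2) finT finS by (metis card_le_sym_Diff antisym order_refl)
    then have "card (sym_diff T S) \<le> 2 * q"
      using T(3) card_Un_le[of "T - S" "S - T"] by linarith
    then show "sym_diff T S \<subseteq> V \<and> card (sym_diff T S) \<le> 2 * q" using T S by auto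
  qed
  ultimately have "card ?T \<le> card ?D"
    by (rule card_inj_on_le) (use V in simp)
  also have "\<dots> \<le> 2 ^ (24 * q)" by (rule card_small_subsets_le[OF V])
  finally have cT: "card ?T \<le> 2 ^ (24 * q)" .
  have "real (2 ^ (48 * q)) \<le> 2 ^ card S" using S(2) by (simp add: power_increasing)
  also have "\<dots> \<le> (real (card V) / real (card S)) ^ card S"
    by (rule power_mono) (use S V False in \<open>auto simp: field_simps\<close>)
  also have "\<dots> \<le> real ?c"
    by (rule binomial_ge_n_over_k_pow_k) (use S V in auto)
  finally have c: "2 ^ (48 * q) \<le> ?c" by (simp only: of_nat_le_iff)
  have "?B \<subseteq> (\<Union>T\<in>?T. ?A T)"
  proof
    fix p assume "p \<in> ?B"
    then have p: "p permutes V" "card (p ` S - S) \<le> q" by auto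
    have "p ` S \<subseteq> V" using p S(1) by (auto simp: permutes_in_image)
    moreover have "card (p ` S) = card S"
      using permutes_inj[OF p(1)] by (simp add: card_image inj_on_subset)
    ultimately show "p \<in> (\<Union>T\<in>?T. ?A T)" using p by auto
  qed
  then have "card ?B \<le> card (\<Union>T\<in>?T. ?A T)"
    by (rule card_mono[rotated]) (use V finite_permutations[OF V(1)] in auto)
  also have "\<dots> \<le> (\<Sum>T\<in>?T. card (?A T))" by (rule card_UN_le) (use V in simp)
  finally have "card ?B * ?c \<le> (\<Sum>T\<in>?T. card (?A T) * ?c)"
    by (simp add: sum_distrib_right[symmetric])
  also have "\<dots> = (\<Sum>T\<in>?T. fact (card V))"
    by (rule sum.cong[OF refl], rule card_permutes_image) (use V S in auto)
  also have "\<dots> \<le> 2 ^ (24 * q) * fact (card V)" using cT by simp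
  finally have "card ?B * ?c \<le> 2 ^ (24 * q) * fact (card V)" .
  moreover have "card ?B * 2 ^ (24 * q) * 2 ^ (24 * q) \<le> card ?B * ?c"
    unfolding mult.assoc power_add[symmetric] using c by (intro mult_left_mono) auto
  ultimately have "(card ?B * 2 ^ (24 * q)) * 2 ^ (24 * q) \<le> fact (card V) * 2 ^ (24 * q)"
    unfolding mult.commute[of "fact (card V)"] by (rule order_trans[rotated])
  then show ?thesis by simp
qed

text \<open>A union bound over at most 2^(384 q) sets \<open>S\<close>, phrased by counting lists:
  17 independent permutations all fail on a given \<open>S\<close> with probability at most 2^(-408
  q). With 16 the estimate would only give 2^(-384 q), just not enough.\<close>

lemma expanding_permutations_exist:
  assumes V: "finite V" "card V = 384 * q" and q: "q > 0"
  obtains ps where "length ps = 17" "\<And>p. p \<in> set ps \<Longrightarrow> p permutes V"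
    "\<And>S. \<lbrakk>S \<subseteq> V; 48 * q \<le> card S; card S \<le> 192 * q\<rbrakk> \<Longrightarrow> \<exists>p\<in>set ps. q < card (p ` S - S)"
proof -
  let ?P = "{p. p permutes V}"
  let ?B = "\<lambda>S. {p. p permutes V \<and> card (p ` S - S) \<le> q}"
  let ?L = "\<lambda>A. {xs. set xs \<subseteq> A \<and> length xs = 17}"
  let ?S = "{S. S \<subseteq> V \<and> 48 * q \<le> card S \<and> card S \<le> 192 * q}"
  have finP: "finite ?P" by (rule finite_permutations[OF V(1)])
  have finB: "finite (?B S)" for S using finP by (rule rev_finite_subset) auto
  have "card (\<Union>S\<in>?S. ?L (?B S)) \<le> (\<Sum>S\<in>?S. card (?L (?B S)))"
    by (rule card_UN_le) (use V in simp)
  also have "\<dots> = (\<Sum>S\<in>?S. card (?B S) ^ 17)"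
    using finB by (simp add: card_lists_length_eq)
  finally have "card (\<Union>S\<in>?S. ?L (?B S)) * (2 ^ (24 * q)) ^ 17
      \<le> (\<Sum>S\<in>?S. (card (?B S) * 2 ^ (24 * q)) ^ 17)"
    by (simp add: sum_distrib_right[symmetric] power_mult_distrib)
  also have "\<dots> \<le> (\<Sum>S\<in>?S. fact (card V) ^ 17)"
    by (intro sum_mono power_mono card_nonexpanding_le V) auto
  also have "\<dots> = card ?S * fact (card V) ^ 17" by simp
  also have "\<dots> \<le> 2 ^ card V * fact (card V) ^ 17"
  proof -
    have "card ?S \<le> card (Pow V)" by (rule card_mono) (use V in auto)
    then show ?thesis by (simp add: card_Pow V(1))
  qed
  also have "(2::nat) ^ card V * fact (card V) ^ 17 < (2 ^ (24 * q)) ^ 17 * fact (card V) ^ 17"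
    using q V(2) by (simp add: power_mult[symmetric])
  also have "\<dots> = card (?L ?P) * (2 ^ (24 * q)) ^ 17"
    using finP card_permutations[OF refl V(1)] by (simp add: card_lists_length_eq)
  finally have "card (\<Union>S\<in>?S. ?L (?B S)) < card (?L ?P)" by simp
  moreover have "finite (\<Union>S\<in>?S. ?L (?B S))"
    using V by (intro finite_UN_I finite_lists_length_eq finB) simp
  ultimately have "\<not> ?L ?P \<subseteq> (\<Union>S\<in>?S. ?L (?B S))"
    using card_mono by (meson leD)
  then obtain ps where ps: "ps \<in> ?L ?P" "ps \<notin> (\<Union>S\<in>?S. ?L (?B S))"
    by (meson subsetI)
  show thesis
  proof (rule that)
    show "length ps = 17" using ps(1) by simp
    show perm: "p permutes V" if "p \<in> set ps" for p using ps(1) that by auto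
    show "\<exists>p\<in>set ps. q < card (p ` S - S)" if "S \<subseteq> V" "48 * q \<le> card S" "card S \<le> 192 * q" for S
    proof -
      have "ps \<notin> ?L (?B S)" using ps(2) that by blast
      then have "\<not> set ps \<subseteq> ?B S" using ps(1) by simp
      then show ?thesis using perm by (auto simp: not_le)
    qed
  qed
qed

section \<open>The graph\<close>

text \<open>The edges \<open>{v, Suc v}\<close> only serve to make the graph connected.\<close>

definition perm_graph :: "nat \<Rightarrow> (nat \<Rightarrow> nat) list \<Rightarrow> nat set set" where
  "perm_graph n ps =
     {{v, w} | v w. v < n \<and> w < n \<and> v \<noteq> w \<and> (w = Suc v \<or> (\<exists>p\<in>set ps. w = p v))}"

abbreviation adj :: "'a set set \<Rightarrow> ('a \<times> 'a) set" where
  "adj E \<equiv> {(a, b). {a, b} \<in> E}"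

lemma sym_rtrancl_adj: "(u, v) \<in> (adj E)\<^sup>* \<Longrightarrow> (v, u) \<in> (adj E)\<^sup>*"
  by (rule symD[OF sym_rtrancl]) (auto simp: sym_def insert_commute)

lemma simple_graph_finite: "simple_graph n E \<Longrightarrow> finite E"
  by (rule finite_subset[of _ "Pow {..<n}"]) (auto simp: simple_graph_def)

lemma simple_perm_graph: "simple_graph n (perm_graph n ps)"
  unfolding simple_graph_def perm_graph_def by blast

lemma connected_perm_graph: "graph_connected n (perm_graph n ps)"
proof -
  let ?R = "adj (perm_graph n ps)"
  have *: "(0, v) \<in> ?R\<^sup>*" if "v < n" for v
    using that
  proof (induction v)
    case (Suc v)
    then have "(v, Suc v) \<in> ?R" unfolding perm_graph_def by fastforce
    with Suc show ?case by (meson Suc_lessD rtrancl.rtrancl_into_rtrancl)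
  qed simp
  show ?thesis unfolding graph_connected_def
    using rtrancl_trans[OF sym_rtrancl_adj[OF *] *] by blast
qed

lemma degree_perm_graph:
  assumes "\<And>p. p \<in> set ps \<Longrightarrow> p permutes {..<n}"
  shows "max_degree_le n (perm_graph n ps) (2 + 2 * length ps)"
  unfolding max_degree_le_def
proof (intro allI impI)
  fix v
  \<comment> \<open>A permutation joins \<open>v\<close> to its image and to its preimage, hence the
    factor 2 in the bound.\<close>
  let ?W = "{Suc v, v - 1} \<union> ((\<lambda>p. p v) ` set ps \<union> (\<lambda>p. inv p v) ` set ps)"
  have "{e \<in> perm_graph n ps. v \<in> e} \<subseteq> (\<lambda>w. {v, w}) ` ?W"
  proof
    fix e assume "e \<in> {e \<in> perm_graph n ps. v \<in> e}"
    then obtain a b where ab: "e = {a, b}" "b = Suc a \<or> (\<exists>p\<in>set ps. b = p a)" "v = a \<or> v = b"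
      by (auto simp: perm_graph_def)
    have "a = inv p b" if "p \<in> set ps" "b = p a" for p
      using permutes_inverses(2)[OF assms[OF that(1)]] that(2) by simp
    then show "e \<in> (\<lambda>w. {v, w}) ` ?W"
      using ab by (auto simp: insert_commute image_iff)
  qed
  then have "card {e \<in> perm_graph n ps. v \<in> e} \<le> card ?W"
    by (rule surj_card_le[rotated]) simp
  also have "\<dots> \<le> card {Suc v, v - 1} + (card ((\<lambda>p. p v) ` set ps) + card ((\<lambda>p. inv p v) ` set ps))"
    by (meson card_Un_le add_left_mono order_trans)
  also have "\<dots> \<le> 2 + (length ps + length ps)"
    by (intro add_mono order_trans[OF card_image_le card_length]) (auto simp: card_insert_if)
  finally show "card {e \<in> perm_graph n ps. v \<in> e} \<le> 2 + 2 * length ps" by simp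
qed

section \<open>From expansion to a large connected class after edge deletion\<close>

lemma perm_graph_boundary:
  assumes "p \<in> set ps" "p permutes {..<n}" "S \<subseteq> {..<n}" "finite F"
    and "\<And>u v. \<lbrakk>u \<in> S; v \<notin> S; {u, v} \<in> perm_graph n ps\<rbrakk> \<Longrightarrow> {u, v} \<in> F"
  shows "card (p ` S - S) \<le> card F"
proof -
  let ?B = "{u \<in> S. p u \<notin> S}"
  have "p ` S - S = p ` ?B" by auto
  then have "card (p ` S - S) \<le> card ?B"
    using assms(3) finite_subset by (metis (no_types, lifting) card_image_le finite_lessThan mem_Collect_eq subsetI)
  also have "\<dots> \<le> card F"
  proof (rule card_inj_on_le)
    \<comment> \<open>Only one end of such an edge lies in \<open>S\<close>, so the edge determines
      \<open>u\<close>.\<close>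
    show "inj_on (\<lambda>u. {u, p u}) ?B" by (auto simp: inj_on_def doubleton_eq_iff)
    show "(\<lambda>u. {u, p u}) ` ?B \<subseteq> F"
    proof clarify
      fix u assume u: "u \<in> S" "p u \<notin> S"
      then have "u < n" "p u < n" using assms(2,3) permutes_in_image[OF assms(2), of u] by auto
      then have "{u, p u} \<in> perm_graph n ps" using u assms(1) unfolding perm_graph_def by fastforce
      then show "{u, p u} \<in> F" using u assms(5) by blast
    qed
  qed fact
  finally show ?thesis .
qed

text \<open>\<open>F\<close> will be the set of variables of one conjunction, and \<open>K\<close> a
  set of vertices between which violations can be moved without touching those variables. The paths
  may leave \<open>K\<close>.\<close>

definition robust :: "nat \<Rightarrow> nat \<Rightarrow> nat set set \<Rightarrow> bool" where
  "robust q n E \<longleftrightarrow> (\<forall>F. finite F \<and> card F \<le> q \<longrightarrow>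
     (\<exists>K\<subseteq>{..<n}. 7 * n < 8 * card K \<and> (\<forall>u\<in>K. \<forall>v\<in>K. (u, v) \<in> (adj (E - F))\<^sup>*)))"

text \<open>Expansion excludes sets of medium size whose boundary lies in \<open>F\<close>. If all
  classes were small, adding them one at a time could never jump over this gap, so some class is
  above it.\<close>

lemma robust_perm_graph:
  assumes n: "n = 384 * q" and q: "q > 0"
    and ps: "\<And>p. p \<in> set ps \<Longrightarrow> p permutes {..<n}"
    and exp: "\<And>S. \<lbrakk>S \<subseteq> {..<n}; 48 * q \<le> card S; card S \<le> 192 * q\<rbrakk>
        \<Longrightarrow> \<exists>p\<in>set ps. q < card (p ` S - S)"
  shows "robust q n (perm_graph n ps)"
  unfolding robust_def
proof (intro allI impI)
  fix F :: "nat set set" assume F: "finite F \<and> card F \<le> q"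
  let ?E = "perm_graph n ps"
  let ?R = "(adj (?E - F))\<^sup>*"
  define closed where "closed U \<longleftrightarrow> U \<subseteq> {..<n} \<and> (\<forall>u\<in>U. \<forall>v<n. v \<notin> U \<longrightarrow> {u, v} \<notin> ?E - F)" for U
  have dich0: "card U < 48 * q \<or> 192 * q < card U" if "closed U" for U
  proof (rule ccontr)
    assume "\<not> ?thesis"
    then obtain p where p: "p \<in> set ps" "q < card (p ` U - U)"
      using exp[of U] \<open>closed U\<close> by (auto simp: closed_def)
    have "{u, v} \<in> F" if "u \<in> U" "v \<notin> U" "{u, v} \<in> ?E" for u v
    proof -
      have "v < n" using that(3) by (auto simp: perm_graph_def doubleton_eq_iff)
      then show ?thesis using \<open>closed U\<close> that by (auto simp: closed_def)
    qed
    then have "card (p ` U - U) \<le> card F"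
      using perm_graph_boundary[OF p(1) ps[OF p(1)], of U F] F \<open>closed U\<close>
      by (auto simp: closed_def)
    then show False using p(2) F by simp
  qed
  \<comment> \<open>The complement of a closed set is closed, so sizes from \<open>192 * q\<close>
    to \<open>336 * q\<close> are excluded as well.\<close>
  have dich: "card U < 48 * q \<or> 336 * q < card U" if "closed U" for U
  proof -
    have "closed ({..<n} - U)"
      using \<open>closed U\<close> unfolding closed_def by (metis DiffD1 DiffD2 DiffI Diff_subset insert_commute lessThan_iff)
    moreover have "card ({..<n} - U) = n - card U"
      using \<open>closed U\<close> by (auto simp: closed_def card_Diff_subset finite_subset)
    moreover have "card U \<le> n"
      using \<open>closed U\<close> card_mono[of "{..<n}" U] by (auto simp: closed_def)
    ultimately show ?thesis using dich0[OF that] dich0[of "{..<n} - U"] n by linarith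
  qed
  define cls where "cls v = {u. u < n \<and> (v, u) \<in> ?R}" for v
  have closed_cls: "closed (cls v)" for v
    unfolding closed_def cls_def
    by (auto intro: rtrancl.rtrancl_into_rtrancl)
  have "\<exists>v<n. 336 * q < card (cls v)"
  proof (rule ccontr)
    assume "\<not> ?thesis"
    then have small: "card (cls v) < 48 * q" if "v < n" for v
      using dich[OF closed_cls] that by blast
    let ?P = "\<lambda>U. closed U \<and> card U < 48 * q"
    have "?P {}" using q by (simp add: closed_def)
    \<comment> \<open>Take a largest closed set below the gap. Adding one more small class keeps the
      size under \<open>96 * q\<close>, hence below the gap again, against maximality.\<close>
    then obtain U where U: "closed U" "card U < 48 * q" "\<And>U'. ?P U' \<Longrightarrow> card U' \<le> card U"
      using ex_has_greatest_nat[of ?P "{}" card "48 * q"] by (metis less_imp_le)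
    have "U \<noteq> {..<n}" using U(2) n by auto
    then obtain v where v: "v < n" "v \<notin> U" using U(1) by (auto simp: closed_def)
    let ?U = "U \<union> cls v"
    have cl: "closed ?U" using U(1) closed_cls[of v] by (auto simp: closed_def)
    have "card ?U < 96 * q" using U(2) small[OF v(1)] card_Un_le[of U "cls v"] by linarith
    then have "?P ?U" using dich[OF cl] cl by auto
    then have "card ?U \<le> card U" by (rule U(3))
    moreover have "finite ?U" using cl finite_subset by (auto simp: closed_def)
    moreover have "U \<subset> ?U" using v by (auto simp: cls_def)
    ultimately show False using psubset_card_mono by (metis not_less)
  qed
  then obtain v where v: "v < n" "336 * q < card (cls v)" by blast
  have "(u, w) \<in> ?R" if "u \<in> cls v" "w \<in> cls v" for u w
  proof -
    have "(v, u) \<in> ?R" "(v, w) \<in> ?R" using that by (simp_all add: cls_def)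
    then show ?thesis by (rule rtrancl_trans[OF sym_rtrancl_adj])
  qed
  then show "\<exists>K\<subseteq>{..<n}. 7 * n < 8 * card K \<and> (\<forall>u\<in>K. \<forall>v\<in>K. (u, v) \<in> ?R)"
    using v n by (intro exI[of _ "cls v"]) (auto simp: cls_def)
qed

section \<open>Counting assignments by their violation set\<close>

text \<open>An assignment is encoded by the set \<open>Z\<close> of edges with value 1, so that each
  assignment to \<open>E\<close> is counted once. The conjunction \<open>({}, {})\<close> is
  constantly 1 and gives the plain number of assignments with violation set
  \<open>X\<close>.\<close>

definition viol_count ::
  "nat \<Rightarrow> nat set set \<Rightarrow> (nat \<Rightarrow> bool) \<Rightarrow> nat set set \<times> nat set set \<Rightarrow> nat set \<Rightarrow> real" where
  "viol_count n E lab C X =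
     (\<Sum>Z | Z \<subseteq> E \<and> viol n E lab (\<lambda>e. e \<in> Z) = X. conj_eval C (\<lambda>e. e \<in> Z))"

lemma conj_eval_nonneg: "conj_eval C z \<ge> 0"
  by (simp add: conj_eval_def)

lemma viol_count_nonneg: "viol_count n E lab C X \<ge> 0"
  unfolding viol_count_def by (intro sum_nonneg conj_eval_nonneg)

text \<open>Flipping one edge changes the parity exactly at its two ends.\<close>

lemma viol_toggle_edge:
  assumes E: "finite E" "{u, v} \<in> E" and uv: "u \<noteq> v" "u < n" "v < n"
  shows "viol n E lab (\<lambda>e. e \<in> sym_diff Z {{u, v}}) = sym_diff (viol n E lab (\<lambda>e. e \<in> Z)) {u, v}"
proof -
  have "node_parity E (\<lambda>e. e \<in> sym_diff Z {{u, v}}) x \<longleftrightarrow>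
        node_parity E (\<lambda>e. e \<in> Z) x \<noteq> (x = u \<or> x = v)" for x
  proof (cases "x \<in> {u, v}")
    case True
    let ?A = "{e \<in> E. x \<in> e \<and> e \<in> Z}" and ?B = "{e \<in> E. x \<in> e \<and> e \<in> sym_diff Z {{u, v}}}"
    have fin: "finite ?A" "finite ?B" using E by auto
    show ?thesis
    proof (cases "{u, v} \<in> Z")
      case inZ: True
      then have "?A = insert {u, v} ?B" using True E by auto
      moreover have "{u, v} \<notin> ?B" using inZ by auto
      ultimately have "card ?A = Suc (card ?B)" using fin by simp
      then show ?thesis using True by (auto simp: node_parity_def)
    next
      case notZ: False
      then have "?B = insert {u, v} ?A" using True E by auto
      moreover have "{u, v} \<notin> ?A" using notZ by auto
      ultimately have "card ?B = Suc (card ?A)" using fin by simp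
      then show ?thesis using True by (auto simp: node_parity_def)
    qed
  next
    case False
    then have "{e \<in> E. x \<in> e \<and> e \<in> sym_diff Z {{u, v}}} = {e \<in> E. x \<in> e \<and> e \<in> Z}" by auto
    then show ?thesis using False by (simp add: node_parity_def)
  qed
  then show ?thesis using uv unfolding viol_def by auto
qed

text \<open>Flipping an edge that \<open>C\<close> does not read is an involution on assignments
  that preserves the value of \<open>C\<close> and exchanges the two violation sets.\<close>

lemma viol_count_toggle_edge:
  assumes E: "finite E" "{u, v} \<in> E - (fst C \<union> snd C)" and uv: "u \<noteq> v" "u < n" "v < n"
  shows "viol_count n E lab C (sym_diff X {u, v}) = viol_count n E lab C X"
proof -
  let ?t = "\<lambda>Z. sym_diff Z {{u, v}}"
  have tv: "viol n E lab (\<lambda>e. e \<in> ?t Z) = sym_diff (viol n E lab (\<lambda>e. e \<in> Z)) {u, v}" for Z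
    using viol_toggle_edge[OF E(1) _ uv] E(2) by blast
  have tt: "?t (?t Z) = Z" for Z by auto
  have tE: "?t Z \<subseteq> E" if "Z \<subseteq> E" for Z using that E(2) by auto
  show ?thesis unfolding viol_count_def
  proof (rule sum.reindex_bij_witness[where i = ?t and j = ?t])
    fix Z assume Z: "Z \<in> {Z. Z \<subseteq> E \<and> viol n E lab (\<lambda>e. e \<in> Z) = sym_diff X {u, v}}"
    then have "viol n E lab (\<lambda>e. e \<in> ?t Z) = sym_diff (sym_diff X {u, v}) {u, v}"
      using tv[of Z] by simp
    also have "\<dots> = X" by auto
    finally show "?t Z \<in> {Z. Z \<subseteq> E \<and> viol n E lab (\<lambda>e. e \<in> Z) = X}" using Z tE by blast
    show "conj_eval C (\<lambda>e. e \<in> ?t Z) = conj_eval C (\<lambda>e. e \<in> Z)"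
    proof -
      have "e \<in> ?t Z \<longleftrightarrow> e \<in> Z" if "e \<in> fst C \<union> snd C" for e using that E(2) by auto
      then show ?thesis unfolding conj_eval_def by (metis UnCI)
    qed
    show "?t (?t Z) = Z" by (rule tt)
  next
    fix Z assume Z: "Z \<in> {Z. Z \<subseteq> E \<and> viol n E lab (\<lambda>e. e \<in> Z) = X}"
    then show "?t Z \<in> {Z. Z \<subseteq> E \<and> viol n E lab (\<lambda>e. e \<in> Z) = sym_diff X {u, v}}"
      using tE tv[of Z] by simp
    show "?t (?t Z) = Z" by (rule tt)
  qed
qed

text \<open>Toggling the edges of a path moves a violation along it. The set \<open>sym_diff {u} {v}\<close> is
  \<open>{u, v}\<close>, or empty if \<open>u = v\<close>.\<close>

lemma viol_count_toggle_path:
  assumes G: "simple_graph n E" and path: "(u, v) \<in> (adj (E - (fst C \<union> snd C)))\<^sup>*"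
  shows "viol_count n E lab C (sym_diff X (sym_diff {u} {v})) = viol_count n E lab C X"
  using path
proof (induction arbitrary: X)
  case (step v w)
  then have e: "{v, w} \<in> E - (fst C \<union> snd C)" by simp
  then have vw: "v \<noteq> w" "v < n" "w < n"
    using G unfolding simple_graph_def by (auto simp: doubleton_eq_iff)
  have "sym_diff X (sym_diff {u} {w}) = sym_diff (sym_diff X (sym_diff {u} {v})) {v, w}"
    using vw by auto
  then show ?case
    using viol_count_toggle_edge[OF simple_graph_finite[OF G] e vw] step.IH by simp
qed simp

text \<open>The empty conjunction reads no edge, so every path may be toggled: violations are
  cancelled in pairs, and the last one is moved to the reference vertex 0.\<close>

lemma viol_count_connected:
  assumes G: "simple_graph n E" "graph_connected n E"
    and X: "X \<subseteq> {..<n}" "odd (card X)"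
  shows "viol_count n E lab ({}, {}) X = viol_count n E lab ({}, {}) {0}"
  using X
proof (induction "card X" arbitrary: X rule: less_induct)
  case less
  let ?f = "viol_count n E lab ({}, {})"
  have t: "?f (sym_diff Y (sym_diff {u} {v})) = ?f Y" if "u < n" "v < n" for u v Y
    by (rule viol_count_toggle_path[OF G(1)])
      (use G(2) that in \<open>simp add: graph_connected_def\<close>)
  have fin: "finite X" using less.prems finite_subset by blast
  show ?case
  proof (cases "card X = 1")
    case True
    then obtain x where "X = {x}" by (auto simp: card_1_singleton_iff)
    moreover have "sym_diff {x} (sym_diff {x} {0}) = {0}" by auto
    ultimately show ?thesis using t[of x 0 "{x}"] less.prems by auto
  next
    case False
    then have "2 \<le> card X" using less.prems by (metis One_nat_def Suc_leI even_zero le_neq_implies_less not_gr_zero numeral_2_eq_2)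
    then obtain Y where "Y \<subseteq> X" "card Y = 2" by (meson obtain_subset_with_card_n)
    then obtain u v where uv: "u \<noteq> v" "u \<in> X" "v \<in> X" by (auto simp: card_2_iff)
    have "card (X - {u, v}) + 2 = card X"
      using uv fin \<open>2 \<le> card X\<close> by (simp add: card_Diff_subset)
    then have "card (X - {u, v}) < card X" "odd (card (X - {u, v}))"
      using less.prems(2) by presburger+
    then have "?f (X - {u, v}) = ?f {0}" using less.hyps less.prems(1) by blast
    moreover have "sym_diff X (sym_diff {u} {v}) = X - {u, v}" using uv by auto
    moreover have "?f (sym_diff X (sym_diff {u} {v})) = ?f X"
      using uv less.prems(1) by (intro t) auto
    ultimately show ?thesis by (simp only:)
  qed
qed

text \<open>The all-zero assignment violates exactly the vertices labelled 1, an odd number;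
  \<open>viol_count_connected\<close> carries this over to \<open>{0}\<close>.\<close>

lemma viol_count_pos:
  assumes G: "simple_graph n E" "graph_connected n E" and lab: "odd (card {v. v < n \<and> lab v})"
  shows "viol_count n E lab ({}, {}) {0} > 0"
proof -
  let ?X = "{v. v < n \<and> lab v}"
  have "viol n E lab (\<lambda>e. e \<in> {}) = ?X" by (auto simp: viol_def node_parity_def)
  then have "0 < viol_count n E lab ({}, {}) ?X"
    unfolding viol_count_def
    by (intro sum_pos2[where i = "{}"])
      (auto simp: conj_eval_def simple_graph_finite[OF G(1)])
  also have "\<dots> = viol_count n E lab ({}, {}) {0}"
    by (rule viol_count_connected[OF G _ lab]) auto
  finally show ?thesis .
qed

section \<open>From three violations to five\<close>

text \<open>By invariance and vanishing on singletons, a triple of positive weight meets \<open>K\<close> at most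
  once, and adding any pair from the rest of \<open>K\<close> preserves its weight. A quintuple so obtained
  meets \<open>K\<close> in at most three points and arises from at most three triples.\<close>

lemma five_sets_vs_three_sets:
  fixes f :: "'a set \<Rightarrow> real"
  assumes V: "finite V" "K \<subseteq> V" and nonneg: "\<And>X. f X \<ge> 0"
    and single: "\<And>x. x \<in> V \<Longrightarrow> f {x} = 0"
    and inv: "\<And>X u v. \<lbrakk>u \<in> K; v \<in> K; u \<noteq> v\<rbrakk> \<Longrightarrow> f (sym_diff X {u, v}) = f X"
  shows "real ((card K - 1) choose 2) * (\<Sum>X | X \<subseteq> V \<and> card X = 3. f X)
      \<le> 3 * (\<Sum>Y | Y \<subseteq> V \<and> card Y = 5. f Y)"
proof -
  let ?V3 = "{X. X \<subseteq> V \<and> card X = 3 \<and> 0 < f X}" and ?V5 = "{Y. Y \<subseteq> V \<and> card Y = 5}"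
  let ?D = "\<lambda>X. {D. D \<subseteq> K - X \<and> card D = 2}"
  let ?I = "Sigma ?V3 ?D"
  let ?g = "\<lambda>(X, D). X \<union> D"
  have finK: "finite K" using V finite_subset by blast
  have fin: "finite ?V3" "finite ?V5" "finite (?D X)" for X using V finK by auto
  have KX: "card (K \<inter> X) \<le> 1" if "X \<in> ?V3" for X
  proof (rule ccontr)
    assume "\<not> ?thesis"
    then have "2 \<le> card (K \<inter> X)" by simp
    then obtain D where "D \<subseteq> K \<inter> X" "card D = 2" by (meson obtain_subset_with_card_n)
    then obtain u v where uv: "u \<noteq> v" "u \<in> K" "v \<in> K" "u \<in> X" "v \<in> X" by (auto simp: card_2_iff)
    have "card (X - {u, v}) = 1" using that uv by (simp add: card_Diff_subset)
    then obtain x where x: "X - {u, v} = {x}" by (auto simp: card_1_singleton_iff)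
    moreover have "sym_diff X {u, v} = X - {u, v}" using uv by auto
    ultimately have "f X = f {x}" using inv[of u v X] uv by simp
    also have "\<dots> = 0" using x that by (intro single) auto
    finally show False using that by simp
  qed
  have add: "f (X \<union> D) = f X" if D: "D \<in> ?D X" for X D
  proof -
    obtain u v where uv: "D = {u, v}" "u \<noteq> v" using D by (auto simp: card_2_iff)
    then have "X \<union> D = sym_diff X {u, v}" using D by auto
    then show ?thesis using inv[of u v X] uv D by auto
  qed
  have gI: "?g ` ?I \<subseteq> ?V5"
  proof clarify
    fix X D assume X: "X \<subseteq> V" "card X = 3" and D: "D \<subseteq> K - X" "card D = 2"
    have "finite X" "finite D" using X V D finK finite_subset by (blast, metis finite_Diff finite_subset)
    then have "card (X \<union> D) = 5" using X D by (subst card_Un_disjoint) auto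
    then show "X \<union> D \<subseteq> V \<and> card (X \<union> D) = 5" using X D V by auto
  qed
  have fibre: "card {i \<in> ?I. ?g i = Y} \<le> 3" if "Y \<in> ?V5" for Y
  proof (cases "{i \<in> ?I. ?g i = Y} = {}")
    case False
    then obtain X D where XD: "X \<in> ?V3" "D \<in> ?D X" "X \<union> D = Y" by auto
    have "K \<inter> Y \<subseteq> (K \<inter> X) \<union> D" using XD by auto
    moreover have "finite ((K \<inter> X) \<union> D)" using XD finK by (auto intro: finite_subset)
    ultimately have "card (K \<inter> Y) \<le> card ((K \<inter> X) \<union> D)" by (rule card_mono[rotated])
    also have "\<dots> \<le> card (K \<inter> X) + card D" by (rule card_Un_le)
    also have "\<dots> \<le> 3" using KX[OF XD(1)] XD(2) by simp
    finally have KY: "card (K \<inter> Y) \<le> 3" .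
    have "card {i \<in> ?I. ?g i = Y} \<le> card {D. D \<subseteq> K \<inter> Y \<and> card D = 2}"
    proof (rule card_inj_on_le)
      \<comment> \<open>Since \<open>D\<close> is disjoint from \<open>X\<close>, the triple is
        \<open>Y - D\<close>.\<close>
      show "inj_on snd {i \<in> ?I. ?g i = Y}" by (auto simp: inj_on_def)
      show "snd ` {i \<in> ?I. ?g i = Y} \<subseteq> {D. D \<subseteq> K \<inter> Y \<and> card D = 2}" by auto
      show "finite {D. D \<subseteq> K \<inter> Y \<and> card D = 2}" using finK by simp
    qed
    also have "\<dots> = card (K \<inter> Y) choose 2" by (rule n_subsets) (simp add: finK)
    also have "\<dots> \<le> 3 choose 2" using KY by (rule binomial_right_mono)
    finally show ?thesis by (simp add: choose_two)
  qed (simp only: card.empty)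
  have "(\<Sum>X | X \<subseteq> V \<and> card X = 3. f X) = (\<Sum>X\<in>?V3. f X)"
    using nonneg V by (intro sum.mono_neutral_right) (auto simp: less_le)
  then have "real ((card K - 1) choose 2) * (\<Sum>X | X \<subseteq> V \<and> card X = 3. f X)
      = (\<Sum>X\<in>?V3. real ((card K - 1) choose 2) * f X)" by (simp add: sum_distrib_left)
  also have "\<dots> \<le> (\<Sum>X\<in>?V3. \<Sum>D\<in>?D X. f (X \<union> D))"
  proof (rule sum_mono)
    fix X assume X: "X \<in> ?V3"
    \<comment> \<open>The triple occupies at most one point of \<open>K\<close>, hence
      \<open>card K - 1\<close>.\<close>
    have "card K \<le> card (K - X) + card (K \<inter> X)"
      using finK card_Un_le[of "K - X" "K \<inter> X"] by (simp add: Un_Diff_Int)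
    then have "(card K - 1) choose 2 \<le> card (K - X) choose 2"
      using KX[OF X] by (intro binomial_right_mono) simp
    also have "\<dots> = card (?D X)" using finK by (simp add: n_subsets)
    finally have "real ((card K - 1) choose 2) * f X \<le> real (card (?D X)) * f X"
      using nonneg by (intro mult_right_mono) simp_all
    also have "\<dots> = (\<Sum>D\<in>?D X. f (X \<union> D))" using add by simp
    finally show "real ((card K - 1) choose 2) * f X \<le> (\<Sum>D\<in>?D X. f (X \<union> D))" .
  qed
  also have "\<dots> = (\<Sum>i\<in>?I. f (?g i))"
    using fin by (subst sum.Sigma) (auto simp: case_prod_unfold)
  \<comment> \<open>Double counting: the pairs of a triple and an added pair are regrouped by the
    resulting quintuple.\<close>
  also have "\<dots> = (\<Sum>Y\<in>?V5. \<Sum>i\<in>{i \<in> ?I. ?g i = Y}. f (?g i))"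
    by (rule sum.group[symmetric]) (use fin gI in auto)
  also have "\<dots> \<le> (\<Sum>Y\<in>?V5. 3 * f Y)"
  proof (rule sum_mono)
    fix Y assume Y: "Y \<in> ?V5"
    have "(\<Sum>i\<in>{i \<in> ?I. ?g i = Y}. f (?g i)) = real (card {i \<in> ?I. ?g i = Y}) * f Y"
      by simp
    also have "\<dots> \<le> 3 * f Y"
      using fibre[OF Y] nonneg by (intro mult_right_mono) simp_all
    finally show "(\<Sum>i\<in>{i \<in> ?I. ?g i = Y}. f (?g i)) \<le> 3 * f Y" .
  qed
  finally show ?thesis by (simp add: sum_distrib_left)
qed

section \<open>The degree bound\<close>

text \<open>Exchange the sums: the junta equals k - 1 on each assignment with k violations, and
  every odd violation set arises from equally many assignments. It is used for k = 3 and k =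
  5.\<close>

lemma junta_viol_count_sum:
  assumes G: "simple_graph n E" "graph_connected n E"
    and eval: "\<And>z. junta_eval S w z = real (card (viol n E lab z)) - 1" and k: "odd k"
  shows "(\<Sum>C\<in>S. w C * (\<Sum>X | X \<subseteq> {..<n} \<and> card X = k. viol_count n E lab C X))
      = (real k - 1) * viol_count n E lab ({}, {}) {0} * real (n choose k)"
proof -
  let ?X = "{X. X \<subseteq> {..<n} \<and> card X = k}"
  let ?Z = "\<lambda>X. {Z. Z \<subseteq> E \<and> viol n E lab (\<lambda>e. e \<in> Z) = X}"
  have "(\<Sum>C\<in>S. w C * (\<Sum>X\<in>?X. viol_count n E lab C X))
      = (\<Sum>C\<in>S. \<Sum>X\<in>?X. \<Sum>Z\<in>?Z X. w C * conj_eval C (\<lambda>e. e \<in> Z))"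
    unfolding viol_count_def by (simp add: sum_distrib_left)
  also have "\<dots> = (\<Sum>X\<in>?X. \<Sum>C\<in>S. \<Sum>Z\<in>?Z X. w C * conj_eval C (\<lambda>e. e \<in> Z))"
    by (rule sum.swap)
  also have "\<dots> = (\<Sum>X\<in>?X. \<Sum>Z\<in>?Z X. \<Sum>C\<in>S. w C * conj_eval C (\<lambda>e. e \<in> Z))"
    by (intro sum.cong refl) (rule sum.swap)
  \<comment> \<open>The factor for the empty conjunction is 1; it turns the inner sum back into a
    \<open>viol_count\<close>.\<close>
  also have "\<dots> = (\<Sum>X\<in>?X. \<Sum>Z\<in>?Z X. (real k - 1) * conj_eval ({}, {}) (\<lambda>e. e \<in> Z))"
    using eval by (intro sum.cong refl) (simp add: junta_eval_def conj_eval_def)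
  also have "\<dots> = (\<Sum>X\<in>?X. (real k - 1) * viol_count n E lab ({}, {}) X)"
    unfolding viol_count_def by (simp only: sum_distrib_left)
  also have "\<dots> = (\<Sum>X\<in>?X. (real k - 1) * viol_count n E lab ({}, {}) {0})"
    using k by (intro sum.cong refl) (simp add: viol_count_connected[OF G])
  also have "\<dots> = (real k - 1) * viol_count n E lab ({}, {}) {0} * real (n choose k)"
    by (simp add: n_subsets)
  finally show ?thesis .
qed

text \<open>Robustness applied to the at most \<open>q\<close> edges read by \<open>C\<close>
  supplies the set \<open>K\<close> for \<open>five_sets_vs_three_sets\<close>.\<close>

lemma five_vs_three_conjunction:
  assumes G: "simple_graph n E" "robust q n E"
    and C: "conj_width C \<le> q" "finite (fst C)" "finite (snd C)"
    and zero: "\<And>z. card (viol n E lab z) = 1 \<Longrightarrow> conj_eval C z = 0"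
    and n: "n = 384 * q"
  shows "real ((336 * q) choose 2) * (\<Sum>X | X \<subseteq> {..<n} \<and> card X = 3. viol_count n E lab C X)
      \<le> 3 * (\<Sum>Y | Y \<subseteq> {..<n} \<and> card Y = 5. viol_count n E lab C Y)"
proof -
  let ?F = "fst C \<union> snd C"
  have "card ?F \<le> q" using C(1) card_Un_le[of "fst C" "snd C"] by (simp add: conj_width_def)
  then obtain K where K: "K \<subseteq> {..<n}" "7 * n < 8 * card K"
    "\<And>u v. \<lbrakk>u \<in> K; v \<in> K\<rbrakk> \<Longrightarrow> (u, v) \<in> (adj (E - ?F))\<^sup>*"
    using G(2)[unfolded robust_def, rule_format, of ?F] C(2,3) by auto
  let ?s = "\<Sum>X | X \<subseteq> {..<n} \<and> card X = 3. viol_count n E lab C X"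
  \<comment> \<open>Here \<open>336 * q\<close> is 7/8 of \<open>n\<close>; the strict inequality
    for \<open>card K\<close> absorbs the subtracted 1.\<close>
  have "336 * q \<le> card K - 1" using K(2) n by simp
  then have "real ((336 * q) choose 2) * ?s \<le> real ((card K - 1) choose 2) * ?s"
    by (intro mult_right_mono sum_nonneg viol_count_nonneg) (simp add: binomial_right_mono)
  also have "\<dots> \<le> 3 * (\<Sum>Y | Y \<subseteq> {..<n} \<and> card Y = 5. viol_count n E lab C Y)"
  proof (rule five_sets_vs_three_sets)
    show "viol_count n E lab C {x} = 0" if "x \<in> {..<n}" for x
      unfolding viol_count_def by (intro sum.neutral) (auto intro: zero)
    show "viol_count n E lab C (sym_diff X {u, v}) = viol_count n E lab C X"
      if "u \<in> K" "v \<in> K" "u \<noteq> v" for X u v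
    proof -
      have "{u, v} = sym_diff {u} {v}" using that by auto
      then show ?thesis using viol_count_toggle_path[OF G(1) K(3)[OF that(1,2)]] by simp
    qed
  qed (use K viol_count_nonneg in auto)
  finally show ?thesis .
qed

text \<open>Both sides count the 5-sets with an ordered pair of distinct points marked.\<close>

lemma choose_five_three: "20 * (n choose 5) = (n choose 3) * ((n - 3) * (n - 4))"
proof -
  have a: "5 * (n choose 5) = (n choose 4) * (n - 4)"
    using binomial_absorption[of 4 n] binomial_absorb_comp[of n 4] by (simp add: mult.commute)
  have b: "4 * (n choose 4) = (n choose 3) * (n - 3)"
    using binomial_absorption[of 3 n] binomial_absorb_comp[of n 3] by (simp add: mult.commute)
  have "20 * (n choose 5) = 4 * (n choose 4) * (n - 4)" using a by simp
  then show ?thesis using b by simp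
qed

lemma degree_lower_bound:
  assumes G: "simple_graph n E" "graph_connected n E" "robust q n E" and n: "n = 384 * q" "q > 0"
    and lab: "odd (card {v. v < n \<and> lab v})" and J: "conical_junta E S w"
    and eval: "\<And>z. junta_eval S w z = real (card (viol n E lab z)) - 1"
  shows "q \<le> junta_degree S w"
proof (rule ccontr)
  assume "\<not> ?thesis"
  then have small: "junta_degree S w < q" by simp
  have S: "finite S" "\<And>C. C \<in> S \<Longrightarrow> fst C \<subseteq> E \<and> snd C \<subseteq> E \<and> w C \<ge> 0"
    using J by (auto simp: conical_junta_def)
  let ?s = "\<lambda>k C. \<Sum>X | X \<subseteq> {..<n} \<and> card X = k. viol_count n E lab C X"
  let ?B = "real ((336 * q) choose 2)"
  let ?M = "viol_count n E lab ({}, {}) {0}"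
  have each: "w C * (?B * ?s 3 C) \<le> w C * (3 * ?s 5 C)" if C: "C \<in> S" for C
  \<comment> \<open>Conjunctions of weight 0 may be wide, since the degree ignores them; for them
    both sides vanish.\<close>
  proof (cases "w C = 0")
    case False
    then have pos: "w C > 0" using S(2)[OF C] by simp
    then have "conj_width C \<le> junta_degree S w"
      unfolding junta_degree_def using S(1) C by (intro Max_ge) auto
    then have width: "conj_width C \<le> q" using small by simp
    have zero: "conj_eval C z = 0" if "card (viol n E lab z) = 1" for z
    proof -
      \<comment> \<open>With one violation the junta is 0, so each of its nonnegative terms is
        0.\<close>
      have "(\<Sum>C\<in>S. w C * conj_eval C z) = 0" using eval[of z] that by (simp add: junta_eval_def)
      then have "w C * conj_eval C z = 0"
        using S C by (subst (asm) sum_nonneg_eq_0_iff) (auto intro: mult_nonneg_nonneg conj_eval_nonneg)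
      then show ?thesis using pos by simp
    qed
    have "finite (fst C)" "finite (snd C)"
      using S(2)[OF C] simple_graph_finite[OF G(1)] finite_subset by auto
    then show ?thesis
      using five_vs_three_conjunction[OF G(1,3) width _ _ zero n(1)] pos by simp
  qed simp
  have "?B * (\<Sum>C\<in>S. w C * ?s 3 C) \<le> 3 * (\<Sum>C\<in>S. w C * ?s 5 C)"
  proof -
    have "?B * (\<Sum>C\<in>S. w C * ?s 3 C) = (\<Sum>C\<in>S. w C * (?B * ?s 3 C))"
      by (subst sum_distrib_left) (simp only: mult.left_commute)
    also have "\<dots> \<le> (\<Sum>C\<in>S. w C * (3 * ?s 5 C))" by (rule sum_mono) (rule each)
    also have "\<dots> = 3 * (\<Sum>C\<in>S. w C * ?s 5 C)"
      by (subst (2) sum_distrib_left) (simp only: mult.left_commute)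
    finally show ?thesis .
  qed
  \<comment> \<open>The junta takes the values 2 and 4 on three and five violations; the positive
    count \<open>?M\<close> then cancels.\<close>
  then have "?B * (2 * ?M * real (n choose 3)) \<le> 3 * (4 * ?M * real (n choose 5))"
    by (simp add: junta_viol_count_sum[OF G(1,2) eval])
  then have "?M * (?B * real (n choose 3)) \<le> ?M * (6 * real (n choose 5))"
    by (simp add: mult_ac)
  then have "?B * real (n choose 3) \<le> 6 * real (n choose 5)"
    using viol_count_pos[OF G(1,2) lab] by simp
  then have "real (((336 * q) choose 2) * (n choose 3)) \<le> real (6 * (n choose 5))"
    by (simp only: of_nat_mult of_nat_numeral)
  then have "((336 * q) choose 2) * (n choose 3) \<le> 6 * (n choose 5)"
    by (simp only: of_nat_le_iff)
  then have "10 * (((336 * q) choose 2) * (n choose 3)) \<le> 3 * (20 * (n choose 5))" by linarith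
  also have "\<dots> = 3 * ((n - 3) * (n - 4)) * (n choose 3)"
    using choose_five_three[of n] by (simp only: mult_ac)
  finally have "10 * ((336 * q) choose 2) * (n choose 3) \<le> 3 * ((n - 3) * (n - 4)) * (n choose 3)"
    by (simp only: mult.assoc)
  moreover have "0 < n choose 3" using n by (simp add: zero_less_binomial_iff)
  ultimately have "10 * ((336 * q) choose 2) \<le> 3 * ((n - 3) * (n - 4))"
    by (simp only: mult_le_cancel2)
  also have "\<dots> \<le> 3 * (n * n)" by (intro mult_le_mono) auto
  finally have le: "10 * ((336 * q) choose 2) \<le> 3 * (n * n)" .
  \<comment> \<open>As \<open>q\<close> is at least 1, \<open>336 * q - 1\<close> is at least
    \<open>335 * q\<close>. The contradiction is 5 * 336 * 335 = 562800 > 442368 = 3 *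
    384^2.\<close>
  have "336 * q * (335 * q) \<le> 336 * q * (336 * q - 1)" using n(2) by (intro mult_le_mono) auto
  also have "\<dots> = 2 * ((336 * q) choose 2)" by (simp add: choose_two)
  finally have "5 * (336 * q * (335 * q)) \<le> 3 * (n * n)" using le by linarith
  then show False using n by simp
qed

theorem theorem3:
  shows "\<exists>(d::nat) (c::real). c > 0 \<and>
    (\<forall>N. \<exists>n\<ge>N. \<exists>E. simple_graph n E \<and> graph_connected n E \<and> max_degree_le n E d \<and>
       (\<forall>lab S w. odd (card {v. v < n \<and> lab v}) \<longrightarrow> conical_junta E S w \<longrightarrow>
          (\<forall>z. junta_eval S w z = real (card (viol n E lab z)) - 1) \<longrightarrow>
          real (junta_degree S w) \<ge> c * real n))"
\<comment> \<open>The degree bound is 2 + 2 * 17 for 17 permutations, and the junta degree is at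
  least \<open>q\<close>, which is n / 384.\<close>
proof (rule exI[of _ 36], rule exI[of _ "1 / 384"], intro conjI allI)
  show "(1 / 384 :: real) > 0" by simp
  fix N :: nat
  define q where "q = Suc N"
  define n where "n = 384 * q"
  obtain ps where ps: "length ps = 17" "\<And>p. p \<in> set ps \<Longrightarrow> p permutes {..<n}"
    "\<And>S. \<lbrakk>S \<subseteq> {..<n}; 48 * q \<le> card S; card S \<le> 192 * q\<rbrakk> \<Longrightarrow> \<exists>p\<in>set ps. q < card (p ` S - S)"
    using expanding_permutations_exist[of "{..<n}" q] by (auto simp: n_def q_def)
  let ?E = "perm_graph n ps"
  have "robust q n ?E" by (rule robust_perm_graph[OF n_def _ ps(2,3)]) (simp_all add: q_def)
  then have "real (junta_degree S w) \<ge> 1 / 384 * real n"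
    if "odd (card {v. v < n \<and> lab v})" "conical_junta ?E S w"
      "\<forall>z. junta_eval S w z = real (card (viol n ?E lab z)) - 1" for lab S w
    using degree_lower_bound[OF simple_perm_graph connected_perm_graph _ n_def _ that(1,2)] that(3)
    by (simp add: n_def q_def)
  moreover have "max_degree_le n ?E 36" using degree_perm_graph[of ps n] ps by simp
  moreover have "N \<le> n" by (simp add: n_def q_def)
  ultimately show "\<exists>n\<ge>N. \<exists>E. simple_graph n E \<and> graph_connected n E \<and> max_degree_le n E 36 \<and>
       (\<forall>lab S w. odd (card {v. v < n \<and> lab v}) \<longrightarrow> conical_junta E S w \<longrightarrow>
          (\<forall>z. junta_eval S w z = real (card (viol n E lab z)) - 1) \<longrightarrow>
          real (junta_degree S w) \<ge> 1 / 384 * real n)"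
    using simple_perm_graph connected_perm_graph by blast
qed

end
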